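(* Let $\mu=\sum_{k=1}^{K}a_k\mu_k$ and $\nu=\sum_{l=1}^{L}b_l\nu_l$ be Gaussian mixtures on $\mathbb{R}^d$, where $a_k>0$, $b_l>0$, $\sum_k a_k=\sum_l b_l=1$, and $\mu_k=\mathcal N(m_{0,k},\Sigma_{0,k})$, $\nu_l=\mathcal N(m_{1,l},\Sigma_{1,l})$ are Gaussian probability measures with positive definite covariance matrices. Let $C_G=(c_{kl})\in\mathbb{R}_{\ge0}^{K\times L}$, $c_{kl}=W_2^2(\mu_k,\nu_l)$. Fix $\varepsilon>0$. For $\lambda>0$ let $\omega^{\varepsilon,\lambda}$ be the real--real block (upper-left $K\times L$ block) of the minimizer of the entropic partial optimal transport problem for the weight vectors $a,b$ with cost matrix $C_G$, and let $\omega^{\varepsilon}$ be the unique minimizer of the balanced entropic optimal transport problem with the same weights and cost matrix. Let $\gamma^{\varepsilon,\lambda}=\gamma_{\omega^{\varepsilon,\lambda}}$ and $\gamma^{\varepsilon}=\gamma_{\omega^{\varepsilon}}$ be the induced transport plans. Then $\gamma^{\varepsilon,\lambda}$ converges narrowly to $\gamma^{\varepsilon}$ as $\lambda\to\infty$; that is, for every $\varphi\in C_b(\mathbb{R}^d\times\mathbb{R}^d)$, $$\lim_{\lambda\to\infty}\int_{\mathbb{R}^d\times\mathbb{R}^d}\varphi(x,y)\,\mathrm{d}\gamma^{\varepsilon,\lambda}(x,y)=\int_{\mathbb{R}^d\times\mathbb{R}^d}\varphi(x,y)\,\mathrm{d}\gamma^{\varepsilon}(x,y).$$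
   Context: $W_2$ is the $2$-Wasserstein distance for the Euclidean distance. For nonnegative vectors $r,s$ of equal total mass, $\Pi(r,s)$ is the set of nonnegative matrices with row sums $r$ and column sums $s$. For a nonnegative matrix $A$, $E(A)=\sum_{i,j}A_{ij}(\log A_{ij}-1)$, with $0\log 0=0$. Put $a=(a_1,\dots,a_K)$, $b=(b_1,\dots,b_L)$, $\widetilde a=(a_1,\dots,a_K,1)$, $\widetilde b=(b_1,\dots,b_L,1)$, and $\widetilde c^{\lambda}_{kl}=c_{kl}-2\lambda$ for $1\le k\le K$, $1\le l\le L$, $\widetilde c^{\lambda}_{kl}=0$ if $k=K+1$ or $l=L+1$. The entropic partial optimal transport (EPOT) problem is $$\min_{\Gamma\in\Pi(\widetilde a,\widetilde b)}\left\{\sum_{k=1}^{K+1}\sum_{l=1}^{L+1}\widetilde c^{\lambda}_{kl}\Gamma_{kl}+\varepsilon E(\Gamma)+2\lambda\right\},$$ and the balanced entropic problem is $$\min_{\omega\in\Pi(a,b)}\left\{\sum_{k=1}^{K}\sum_{l=1}^{L}c_{kl}\omega_{kl}+\varepsilon E(\omega)\right\};$$ both have unique minimizers. The optimal transport map from $\mu_k$ to $\nu_l$ is $$T_{kl}(x)=m_{1,l}+A_{kl}(x-m_{0,k}),\qquad A_{kl}=\Sigma_{0,k}^{-1/2}\bigl(\Sigma_{0,k}^{1/2}\Sigma_{1,l}\Sigma_{0,k}^{1/2}\bigr)^{1/2}\Sigma_{0,k}^{-1/2}.$$ For a nonnegative $K\times L$ matrix $\omega$ with row sums at most $a$ and column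 sums at most $b$ (componentwise), the induced plan is the finite measure $\gamma_\omega=\sum_{k=1}^{K}\sum_{l=1}^{L}\omega_{kl}(\mathrm{Id},T_{kl})_\#\mu_k$ on $\mathbb{R}^d\times\mathbb{R}^d$. $C_b$ denotes bounded continuous real functions. *)

theory Defs
  imports "HOL-Analysis.Analysis"
begin

section \<open>Gaussian measures, mixtures and the Wasserstein distance\<close>

definition psd_matrix :: "real^'n^'n \<Rightarrow> bool" where
  "psd_matrix A \<longleftrightarrow> transpose A = A \<and> (\<forall>x. 0 \<le> x \<bullet> (A *v x))"

definition pd_matrix :: "real^'n^'n \<Rightarrow> bool" where
  "pd_matrix A \<longleftrightarrow> transpose A = A \<and> (\<forall>x. x \<noteq> 0 \<longrightarrow> 0 < x \<bullet> (A *v x))"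

definition matrix_sqrt :: "real^'n^'n \<Rightarrow> real^'n^'n" where
  "matrix_sqrt A = (THE B. psd_matrix B \<and> B ** B = A)"

definition gaussian_measure :: "real^'d \<Rightarrow> real^'d^'d \<Rightarrow> (real^'d) measure" where
  "gaussian_measure m S =
     density lborel (\<lambda>x. ennreal
       (exp (- ((x - m) \<bullet> (matrix_inv S *v (x - m))) / 2) /
        sqrt ((2 * pi) ^ CARD('d) * det S)))"

text \<open>The finite weighted sum of Borel measures. The weights are meant to be nonnegative
  (\<^const>\<open>ennreal\<close> sends negative numbers to \<open>0\<close>).\<close>

definition weighted_sum_measure ::
    "('i::finite \<Rightarrow> real) \<Rightarrow> ('i \<Rightarrow> 'a::topological_space measure) \<Rightarrow> 'a measure" where
  "weighted_sum_measure w M =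
     measure_of UNIV (sets borel) (\<lambda>S. \<Sum>i\<in>UNIV. ennreal (w i) * emeasure (M i) S)"

definition couplings :: "'a measure \<Rightarrow> 'b measure \<Rightarrow> ('a \<times> 'b) measure set" where
  "couplings \<mu> \<nu> =
     {\<pi>. sets \<pi> = sets (\<mu> \<Otimes>\<^sub>M \<nu>) \<and> distr \<pi> \<mu> fst = \<mu> \<and> distr \<pi> \<nu> snd = \<nu>}"

text \<open>The infimum is taken in the extended nonnegative reals; it is finite as soon as both
  measures are probability measures with finite second moments. On \<open>real^'d\<close>, \<^const>\<open>dist\<close>
  is the Euclidean distance.\<close>

definition wasserstein2 :: "'a::metric_space measure \<Rightarrow> 'a measure \<Rightarrow> real" where
  "wasserstein2 \<mu> \<nu> =
     sqrt (enn2real (INF \<pi>\<in>couplings \<mu> \<nu>. \<integral>\<^sup>+ z. ennreal ((dist (fst z) (snd z))\<^sup>2) \<partial>\<pi>))"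


section \<open>Discrete entropic transport problems\<close>

text \<open>A \<open>K \<times> L\<close> matrix is an element of \<open>real^'l^'k\<close>, with row index first:
  \<open>\<Gamma> $ k $ l\<close>.\<close>

definition transport_polytope :: "real^'k \<Rightarrow> real^'l \<Rightarrow> (real^'l^'k) set" where
  "transport_polytope r s =
     {\<Gamma>. (\<forall>k l. 0 \<le> \<Gamma> $ k $ l) \<and>
         (\<forall>k. (\<Sum>l\<in>UNIV. \<Gamma> $ k $ l) = r $ k) \<and>
         (\<forall>l. (\<Sum>k\<in>UNIV. \<Gamma> $ k $ l) = s $ l)}"

text \<open>The convention \<open>0 log 0 = 0\<close> holds automatically, because \<open>0 * y = 0\<close>.\<close>

definition entropy_matrix :: "real^'l^'k \<Rightarrow> real" where
  "entropy_matrix A = (\<Sum>k\<in>UNIV. \<Sum>l\<in>UNIV. A $ k $ l * (ln (A $ k $ l) - 1))"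

definition eot_objective :: "real \<Rightarrow> real^'l^'k \<Rightarrow> real^'l^'k \<Rightarrow> real" where
  "eot_objective \<epsilon> c \<omega> =
     (\<Sum>k\<in>UNIV. \<Sum>l\<in>UNIV. c $ k $ l * \<omega> $ k $ l) + \<epsilon> * entropy_matrix \<omega>"

text \<open>For \<open>\<epsilon> > 0\<close> and nonnegative marginals of equal mass the minimizers of this and of
  the partial problem below exist and are unique (compactness and strict convexity), so the
  choice made by \<^const>\<open>arg_min_on\<close> is immaterial.\<close>

definition eot_minimizer :: "real \<Rightarrow> real^'l^'k \<Rightarrow> real^'k \<Rightarrow> real^'l \<Rightarrow> real^'l^'k" where
  "eot_minimizer \<epsilon> c a b = arg_min_on (eot_objective \<epsilon> c) (transport_polytope a b)"

text \<open>The augmented index sets \<open>{1..K+1}\<close> and \<open>{1..L+1}\<close> are the types \<open>'k option\<close> and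
  \<open>'l option\<close>: \<^const>\<open>Some\<close> embeds the original indices and \<^const>\<open>None\<close> is the extra
  (dummy) one.\<close>

definition augmented_weights :: "real^'k \<Rightarrow> real^('k option)" where
  "augmented_weights a = (\<chi> i. case i of Some k \<Rightarrow> a $ k | None \<Rightarrow> 1)"

definition augmented_cost :: "real \<Rightarrow> real^'l^'k \<Rightarrow> real^('l option)^('k option)" where
  "augmented_cost lam c =
     (\<chi> i j. case (i, j) of (Some k, Some l) \<Rightarrow> c $ k $ l - 2 * lam | _ \<Rightarrow> 0)"

definition epot_objective ::
    "real \<Rightarrow> real \<Rightarrow> real^'l^'k \<Rightarrow> real^('l option)^('k option) \<Rightarrow> real" where
  "epot_objective \<epsilon> lam c \<Gamma> =
     (\<Sum>i\<in>UNIV. \<Sum>j\<in>UNIV. augmented_cost lam c $ i $ j * \<Gamma> $ i $ j)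
       + \<epsilon> * entropy_matrix \<Gamma> + 2 * lam"

definition epot_minimizer ::
    "real \<Rightarrow> real \<Rightarrow> real^'l^'k \<Rightarrow> real^'k \<Rightarrow> real^'l \<Rightarrow> real^('l option)^('k option)" where
  "epot_minimizer \<epsilon> lam c a b =
     arg_min_on (epot_objective \<epsilon> lam c)
       (transport_polytope (augmented_weights a) (augmented_weights b))"

definition real_block :: "real^('l option)^('k option) \<Rightarrow> real^'l^'k" where
  "real_block \<Gamma> = (\<chi> k l. \<Gamma> $ Some k $ Some l)"


section \<open>Induced plans\<close>

definition gaussian_ot_matrix :: "real^'d^'d \<Rightarrow> real^'d^'d \<Rightarrow> real^'d^'d" where
  "gaussian_ot_matrix S0 S1 =
     (let R = matrix_sqrt S0
      in matrix_inv R ** matrix_sqrt (R ** S1 ** R) ** matrix_inv R)"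

definition gaussian_ot_map ::
    "real^'d \<Rightarrow> real^'d^'d \<Rightarrow> real^'d \<Rightarrow> real^'d^'d \<Rightarrow> real^'d \<Rightarrow> real^'d" where
  "gaussian_ot_map m0 S0 m1 S1 x = m1 + gaussian_ot_matrix S0 S1 *v (x - m0)"

definition induced_plan ::
    "('k \<Rightarrow> real^'d) \<Rightarrow> ('k \<Rightarrow> real^'d^'d) \<Rightarrow> ('l \<Rightarrow> real^'d) \<Rightarrow> ('l \<Rightarrow> real^'d^'d)
      \<Rightarrow> real^'l^'k \<Rightarrow> ((real^'d) \<times> (real^'d)) measure" where
  "induced_plan m0 S0 m1 S1 \<omega> =
     weighted_sum_measure (\<lambda>(k, l). \<omega> $ k $ l)
       (\<lambda>(k, l). distr (gaussian_measure (m0 k) (S0 k)) borel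
                   (\<lambda>x. (x, gaussian_ot_map (m0 k) (S0 k) (m1 l) (S1 l) x)))"

end

theory Submission
  imports Defs "HOL-Probability.Distributions" "HOL-Real_Asymp.Real_Asymp"
begin

text \<open>Integrating \<open>\<phi>\<close> against an induced plan gives a linear function of \<open>\<omega>\<close>, so it suffices that
  the real block of the partial minimizer tends to the balanced one. If \<open>\<Gamma>\<close> has marginals
  \<open>a, 1\<close> and \<open>b, 1\<close>, its dummy corner entry equals the mass of its real block, so the partial
  objective is \<open>F \<Gamma> + 2\<lambda> (1 - corner)\<close> with \<open>F\<close> continuous and independent of \<open>\<lambda>\<close>. Comparing
  with the balanced minimizer bordered by \<open>0\<close> and corner \<open>1\<close> bounds \<open>\<lambda> (1 - corner)\<close> and \<open>F\<close>; every
  cluster point therefore has corner \<open>1\<close>, hence vanishing border, and its real block minimizes the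
  balanced problem, whose minimizer is unique by strict convexity.\<close>

section \<open>Integration against weighted sums of measures\<close>

lemma sets_weighted_sum_measure [simp, measurable_cong]:
  "sets (weighted_sum_measure w M) = sets borel"
  unfolding weighted_sum_measure_def by (metis sets.sigma_sets_eq sets_measure_of space_borel top_greatest Pow_UNIV)

text \<open>\<open>measure_of\<close> reproduces the prescribed set function only if that function
  is countably additive; this follows by exchanging the series with the finite sum over
  components.\<close>

lemma emeasure_weighted_sum_measure:
  fixes M :: "'i::finite \<Rightarrow> 'a::topological_space measure"
  assumes "\<And>i. sets (M i) = sets borel" and "A \<in> sets borel"
  shows "emeasure (weighted_sum_measure w M) A = (\<Sum>i\<in>UNIV. ennreal (w i) * emeasure (M i) A)"
proof (rule emeasure_measure_of[OF weighted_sum_measure_def])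
  show "countably_additive (sets (weighted_sum_measure w M))
      (\<lambda>S. \<Sum>i\<in>UNIV. ennreal (w i) * emeasure (M i) S)"
  proof (rule countably_additiveI)
    fix B :: "nat \<Rightarrow> 'a set"
    assume B: "range B \<subseteq> sets (weighted_sum_measure w M)" "disjoint_family B"
    have "(\<Sum>n. \<Sum>i\<in>UNIV. ennreal (w i) * emeasure (M i) (B n))
        = (\<Sum>i\<in>UNIV. \<Sum>n. ennreal (w i) * emeasure (M i) (B n))"
      by (intro suminf_sum summableI)
    also have "\<dots> = (\<Sum>i\<in>UNIV. ennreal (w i) * emeasure (M i) (\<Union>n. B n))"
      using B assms(1) by (intro sum.cong) (auto simp: suminf_emeasure)
    finally show "(\<Sum>n. \<Sum>i\<in>UNIV. ennreal (w i) * emeasure (M i) (B n))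
        = (\<Sum>i\<in>UNIV. ennreal (w i) * emeasure (M i) (\<Union>n. B n))" .
  qed
qed (use assms in \<open>auto simp: positive_def\<close>)

text \<open>Both sides respect scaling, addition and monotone limits, so induction over nonnegative
  measurable functions reduces the claim to indicators, which is the preceding lemma.\<close>

lemma nn_integral_weighted_sum_measure:
  fixes M :: "'i::finite \<Rightarrow> 'a::topological_space measure"
  assumes M: "\<And>i. sets (M i) = sets borel" and f: "f \<in> borel_measurable borel"
  shows "(\<integral>\<^sup>+x. f x \<partial>weighted_sum_measure w M) = (\<Sum>i\<in>UNIV. ennreal (w i) * (\<integral>\<^sup>+x. f x \<partial>M i))"
  using f
proof (induction rule: borel_measurable_induct)
  case (cong f g)
  then have "f = g" by auto
  with cong show ?case by simp
next
  case (set A)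
  then show ?case using M by (simp add: emeasure_weighted_sum_measure)
next
  case (mult u c)
  have "u \<in> borel_measurable (M i)" for i
    using mult.hyps by (simp cong: measurable_cong_sets add: M)
  then show ?case using mult
    by (simp add: nn_integral_cmult sum_distrib_left mult.left_commute)
next
  case (add u v)
  have "u \<in> borel_measurable (M i)" "v \<in> borel_measurable (M i)" for i
    using add.hyps by (simp_all cong: measurable_cong_sets add: M)
  then show ?case using add
    by (simp add: nn_integral_add sum.distrib distrib_left)
next
  case (seq U)
  have U: "U n \<in> borel_measurable (M i)" for i n
    using seq.hyps by (simp cong: measurable_cong_sets add: M)
  have "(\<integral>\<^sup>+x. (SUP n. U n) x \<partial>weighted_sum_measure w M)
      = (SUP n. \<integral>\<^sup>+x. U n x \<partial>weighted_sum_measure w M)"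
    using seq.hyps unfolding SUP_apply by (intro nn_integral_monotone_convergence_SUP) auto
  also have "\<dots> = (SUP n. \<Sum>i\<in>UNIV. ennreal (w i) * (\<integral>\<^sup>+x. U n x \<partial>M i))"
    using seq.IH by simp
  \<comment> \<open>The supremum passes through the finite sum because every summand increases with
    \<open>n\<close>.\<close>
  also have "\<dots> = (\<Sum>i\<in>UNIV. SUP n. ennreal (w i) * (\<integral>\<^sup>+x. U n x \<partial>M i))"
    using \<open>incseq U\<close>
    by (intro ennreal_SUP_sum)
      (auto simp: mono_def le_fun_def intro!: mult_left_mono nn_integral_mono)
  also have "\<dots> = (\<Sum>i\<in>UNIV. ennreal (w i) * (\<integral>\<^sup>+x. (SUP n. U n) x \<partial>M i))"
    using \<open>incseq U\<close> U unfolding SUP_apply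
    by (simp add: SUP_mult_left_ennreal nn_integral_monotone_convergence_SUP)
  finally show ?case by simp
qed

text \<open>Positive and negative parts are treated separately, each with finite integral.
  Nonnegative weights ensure that \<open>ennreal (w i)\<close> converts back to
  \<open>w i\<close>.\<close>

lemma integral_weighted_sum_measure:
  fixes M :: "'i::finite \<Rightarrow> 'a::topological_space measure" and f :: "'a \<Rightarrow> real"
  assumes M: "\<And>i. sets (M i) = sets borel" and w: "\<And>i. 0 \<le> w i"
    and f: "\<And>i. integrable (M i) f"
  shows "(\<integral>x. f x \<partial>weighted_sum_measure w M) = (\<Sum>i\<in>UNIV. w i * (\<integral>x. f x \<partial>M i))"
proof -
  have fm [measurable]: "f \<in> borel_measurable borel"
    using borel_measurable_integrable[OF f] by (simp cong: measurable_cong_sets add: M)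
  let ?p = "\<lambda>i. \<integral>\<^sup>+x. ennreal (f x) \<partial>M i" and ?n = "\<lambda>i. \<integral>\<^sup>+x. ennreal (- f x) \<partial>M i"
  have fin: "?p i \<noteq> \<infinity>" "?n i \<noteq> \<infinity>" for i
    using f[of i] by (auto simp: real_integrable_def)
  have nn: "(\<integral>\<^sup>+x. ennreal (f x) \<partial>weighted_sum_measure w M) = (\<Sum>i\<in>UNIV. ennreal (w i) * ?p i)"
    "(\<integral>\<^sup>+x. ennreal (- f x) \<partial>weighted_sum_measure w M) = (\<Sum>i\<in>UNIV. ennreal (w i) * ?n i)"
    using M by (auto intro!: nn_integral_weighted_sum_measure)
  have int: "integrable (weighted_sum_measure w M) f"
    unfolding real_integrable_def nn using fin by (auto simp: ennreal_mult_eq_top_iff)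
  have "(\<integral>x. f x \<partial>weighted_sum_measure w M)
      = enn2real (\<Sum>i\<in>UNIV. ennreal (w i) * ?p i) - enn2real (\<Sum>i\<in>UNIV. ennreal (w i) * ?n i)"
    by (simp add: real_lebesgue_integral_def[OF int] nn)
  also have "\<dots> = (\<Sum>i\<in>UNIV. w i * enn2real (?p i)) - (\<Sum>i\<in>UNIV. w i * enn2real (?n i))"
    using fin w by (subst (1 2) enn2real_sum) (auto simp: enn2real_mult ennreal_mult_less_top top.not_eq_extremum)
  also have "\<dots> = (\<Sum>i\<in>UNIV. w i * (\<integral>x. f x \<partial>M i))"
    by (simp add: real_lebesgue_integral_def[OF f] sum_subtractf right_diff_distrib)
  finally show ?thesis .
qed

section \<open>Finiteness of Gaussian measures\<close>

text \<open>The form is positive off the origin, since it equals \<open>y \<bullet> (S *v y)\<close>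
  for \<open>y = matrix_inv S *v x\<close>. Its minimum over the compact unit sphere serves as
  \<open>e\<close>, and homogeneity of degree two extends the bound to all vectors.\<close>

lemma pd_matrix_inverse_coercive:
  fixes S :: "real^'d^'d"
  assumes "pd_matrix S"
  obtains e where "0 < e" and "\<And>x. e * (norm x)\<^sup>2 \<le> x \<bullet> (matrix_inv S *v x)"
proof -
  have "\<exists>B. B ** S = mat 1"
    unfolding matrix_left_invertible_ker
    using assms by (force simp: pd_matrix_def)
  then have "invertible S"
    by (simp add: invertible_left_inverse)
  then have "S ** matrix_inv S = mat 1"
    unfolding invertible_def matrix_inv_def by (rule someI2_ex) simp
  then have S_inv: "S *v (matrix_inv S *v x) = x" for x
    by (simp add: matrix_vector_mul_assoc)
  let ?q = "\<lambda>x::real^'d. x \<bullet> (matrix_inv S *v x)"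
  have pos: "0 < ?q x" if "x \<noteq> 0" for x
  proof -
    define y where "y = matrix_inv S *v x"
    have x: "x = S *v y" by (simp add: y_def S_inv)
    then have "y \<noteq> 0" using that by auto
    then have "0 < y \<bullet> (S *v y)"
      using assms by (simp add: pd_matrix_def)
    then show ?thesis
      by (simp add: y_def S_inv inner_commute)
  qed
  have "continuous_on (sphere 0 1) ?q"
    by (intro continuous_intros linear_continuous_on matrix_vector_mul_bounded_linear)
  moreover have "compact (sphere 0 (1::real) :: (real^'d) set)" "sphere 0 1 \<noteq> ({} :: (real^'d) set)"
    by auto
  ultimately obtain u where u: "u \<in> sphere 0 1" and min: "\<And>x. x \<in> sphere 0 1 \<Longrightarrow> ?q u \<le> ?q x"
    by (meson continuous_attains_inf)
  show ?thesis
  proof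
    show "0 < ?q u" using u by (intro pos) auto
    show "?q u * (norm x)\<^sup>2 \<le> ?q x" for x
    proof (cases "x = 0")
      case False
      have "?q u \<le> ?q (x /\<^sub>R norm x)"
        using False by (intro min) simp
      also have "\<dots> = ?q x / (norm x)\<^sup>2"
        by (simp add: matrix_vector_mult_scaleR power2_eq_square field_simps)
      finally show ?thesis using False by (simp add: field_simps)
    qed simp
  qed
qed

text \<open>Finiteness makes bounded continuous functions integrable. By coercivity the density is
  at most a constant times a product of one-dimensional normal densities, each of mass one.\<close>

lemma finite_gaussian_measure:
  fixes m :: "real^'d"
  assumes "pd_matrix S"
  shows "finite_measure (gaussian_measure m S)"
proof
  obtain e where e: "0 < e" and coercive: "\<And>x. e * (norm x)\<^sup>2 \<le> x \<bullet> (matrix_inv S *v x)"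
    using pd_matrix_inverse_coercive[OF assms] by blast
  \<comment> \<open>Variance \<open>1 / e\<close> produces the exponent
    \<open>- e * (t - m \<bullet> b)^2 / 2\<close> matching the coercivity bound; \<open>B\<close>
    below cancels the normalising factors of all coordinates.\<close>
  define N where "N = (\<lambda>(b::real^'d) t. normal_density (m \<bullet> b) (1 / sqrt e) t)"
  define B where "B = sqrt (2 * pi / e) ^ DIM(real^'d)"
  define C where "C = 1 / sqrt ((2 * pi) ^ CARD('d) * det S)"
  define q where "q = (\<lambda>x. (x - m) \<bullet> (matrix_inv S *v (x - m)))"
  have N_nonneg: "0 \<le> N b t" for b t by (simp add: N_def)
  have q_cont: "continuous_on UNIV q"
    unfolding q_def
    by (intro continuous_intros bounded_linear.continuous_on[OF matrix_vector_mul_bounded_linear])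
  then have [measurable]: "q \<in> borel_measurable borel"
    by (rule borel_measurable_continuous_onI)
  have bound: "exp (- q x / 2) \<le> B * (\<Prod>b\<in>Basis. N b (x \<bullet> b))" for x
  proof -
    have N: "N b t = sqrt (e / (2 * pi)) * exp (- (e * (t - m \<bullet> b)\<^sup>2) / 2)" for b t
      using e by (simp add: N_def normal_density_def real_sqrt_divide power_divide field_simps)
    have "B * (\<Prod>b\<in>Basis. N b (x \<bullet> b)) = exp (\<Sum>b\<in>Basis. - (e * (x \<bullet> b - m \<bullet> b)\<^sup>2) / 2)"
      unfolding N prod.distrib B_def
      using e by (simp add: exp_sum power_mult_distrib[symmetric] real_sqrt_mult[symmetric])
    also have "(\<Sum>b\<in>Basis. - (e * (x \<bullet> b - m \<bullet> b)\<^sup>2) / 2) = - (e * (norm (x - m))\<^sup>2) / 2"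
      unfolding power2_norm_eq_inner
      by (subst euclidean_inner)
        (simp add: inner_diff_left power2_eq_square sum_distrib_left sum_negf sum_divide_distrib)
    finally show ?thesis using coercive[of "x - m"] by (simp add: q_def)
  qed
  have "emeasure (gaussian_measure m S) (space (gaussian_measure m S))
      = (\<integral>\<^sup>+x. ennreal (exp (- q x / 2) * C) \<partial>lborel)"
  proof -
    have "gaussian_measure m S = density lborel (\<lambda>x. ennreal (exp (- q x / 2) * C))"
      by (simp only: gaussian_measure_def q_def C_def times_divide_eq_right mult_1_right)
    then show ?thesis by (simp add: emeasure_density)
  qed
  also have "\<dots> \<le> (\<integral>\<^sup>+x. ennreal (B * \<bar>C\<bar>) * ennreal (\<Prod>b\<in>Basis. N b (x \<bullet> b)) \<partial>lborel)"
  proof (intro nn_integral_mono)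
    fix x
    \<comment> \<open>The absolute value gives a bound without determining the sign of
      \<open>det S\<close>.\<close>
    have "exp (- q x / 2) * C \<le> exp (- q x / 2) * \<bar>C\<bar>" by (simp add: mult_left_mono)
    also have "\<dots> \<le> B * (\<Prod>b\<in>Basis. N b (x \<bullet> b)) * \<bar>C\<bar>"
      by (intro mult_right_mono bound) simp
    finally show "ennreal (exp (- q x / 2) * C) \<le> ennreal (B * \<bar>C\<bar>) * ennreal (\<Prod>b\<in>Basis. N b (x \<bullet> b))"
      using e by (subst ennreal_mult[symmetric])
        (auto simp: B_def mult_ac intro!: prod_nonneg N_nonneg ennreal_leI)
  qed
  also have "\<dots> = ennreal (B * \<bar>C\<bar>) * (\<integral>\<^sup>+x. (\<Prod>b\<in>Basis. ennreal (N b (x \<bullet> b))) \<partial>lborel)"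
    by (subst nn_integral_cmult) (auto simp: prod_ennreal N_nonneg N_def)
  also have "\<dots> = ennreal (B * \<bar>C\<bar>) * (\<Prod>b\<in>(Basis::(real^'d) set). \<integral>\<^sup>+t. ennreal (N b t) \<partial>lborel)"
    by (subst nn_integral_lborel_prod) (auto simp: N_def)
  also have "\<dots> = ennreal (B * \<bar>C\<bar>)"
  proof -
    have "(\<integral>\<^sup>+t. ennreal (N b t) \<partial>lborel) = 1" for b
      using prob_space.emeasure_space_1[OF prob_space_normal_density[of "1 / sqrt e" "m \<bullet> b"]] e
      by (simp add: emeasure_density N_def)
    then show ?thesis by simp
  qed
  finally show "emeasure (gaussian_measure m S) (space (gaussian_measure m S)) \<noteq> \<infinity>"
    by (auto simp: top_unique)
qed

section \<open>The entropic transport problem\<close>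

text \<open>The left side is the tangent line at \<open>m\<close> of the convex function
  \<open>t * (ln t - 1)\<close>, whose derivative is \<open>ln t\<close>. For positive
  \<open>x\<close> the gap is \<open>x\<close> times \<open>r - 1 - ln r\<close> with
  \<open>r = m / x\<close>, which vanishes only at \<open>r = 1\<close>.\<close>

lemma entropy_term_tangent_le:
  fixes x m :: real
  assumes "0 \<le> x" "0 < m"
  shows "x * ln m - m \<le> x * (ln x - 1)"
    and "x \<noteq> m \<Longrightarrow> x * ln m - m < x * (ln x - 1)"
proof -
  have *: "x * ln m - m \<le> x * (ln x - 1) \<and> (x \<noteq> m \<longrightarrow> x * ln m - m < x * (ln x - 1))"
  proof (cases "x = 0")
    case False
    with assms have x: "0 < x" by simp
    have eq: "x * (ln x - 1) - (x * ln m - m) = x * (m / x - 1 - ln (m / x))"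
      using x assms by (simp add: ln_div field_simps)
    have "ln (m / x) \<le> m / x - 1"
      using x assms by (intro ln_le_minus_one) simp
    moreover have "ln (m / x) \<noteq> m / x - 1" if "x \<noteq> m"
      using ln_eq_minus_one[of "m / x"] x assms that by (auto simp: field_simps)
    ultimately have "0 \<le> m / x - 1 - ln (m / x)" "x \<noteq> m \<Longrightarrow> 0 < m / x - 1 - ln (m / x)"
      by force+
    with x have "0 \<le> x * (m / x - 1 - ln (m / x))" "x \<noteq> m \<Longrightarrow> 0 < x * (m / x - 1 - ln (m / x))"
      by simp_all
    then show ?thesis unfolding eq[symmetric] by auto
  qed (use assms in auto)
  show "x * ln m - m \<le> x * (ln x - 1)" using * by blast
  show "x \<noteq> m \<Longrightarrow> x * ln m - m < x * (ln x - 1)" using * by blast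
qed

text \<open>Adding the tangent bounds at the midpoint, evaluated at \<open>x\<close> and
  \<open>y\<close>, cancels the linear terms. If \<open>x \<noteq> y\<close>, then \<open>m\<close>
  is positive and differs from both points, so the bounds are strict; if \<open>x = y\<close>,
  equality is immediate, even at zero where there is no tangent.\<close>

lemma entropy_term_midpoint:
  fixes x y :: real
  assumes "0 \<le> x" "0 \<le> y"
  defines "m \<equiv> (x + y) / 2"
  shows "2 * (m * (ln m - 1)) \<le> x * (ln x - 1) + y * (ln y - 1)"
    and "x \<noteq> y \<Longrightarrow> 2 * (m * (ln m - 1)) < x * (ln x - 1) + y * (ln y - 1)"
proof -
  have eq: "2 * (m * (ln m - 1)) = (x * ln m - m) + (y * ln m - m)"
    by (simp add: m_def algebra_simps add_divide_distrib)
  show lt: "2 * (m * (ln m - 1)) < x * (ln x - 1) + y * (ln y - 1)" if "x \<noteq> y"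
    unfolding eq using assms that
    by (intro add_strict_mono entropy_term_tangent_le(2)) (auto simp: m_def)
  show "2 * (m * (ln m - 1)) \<le> x * (ln x - 1) + y * (ln y - 1)"
    by (cases "x = y") (use lt in \<open>auto simp: m_def\<close>)
qed

text \<open>The only delicate point is zero, where the one-sided limit agrees with the convention
  that the value is zero.\<close>

lemma continuous_on_entropy_term: "continuous_on {0..} (\<lambda>x::real. x * (ln x - 1))"
proof -
  have "((\<lambda>x::real. x * (ln x - 1)) \<longlongrightarrow> y * (ln y - 1)) (at y within {0..})" if "0 \<le> y" for y
  proof (cases "y = 0")
    case True
    have "((\<lambda>x::real. x * (ln x - 1)) \<longlongrightarrow> 0) (at_right 0)" by real_asymp
    moreover have "at (0::real) within {0..} = at_right 0"
      by (rule at_within_Ici_at_right)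
    ultimately show ?thesis using True by simp
  next
    case False
    with that show ?thesis by (auto intro!: tendsto_intros)
  qed
  then show ?thesis by (simp add: continuous_on_def)
qed

section \<open>Continuity, compactness, and existence and uniqueness of minimizers\<close>

lemma continuous_on_entropy_matrix: "continuous_on (transport_polytope r s) entropy_matrix"
  unfolding entropy_matrix_def
  by (intro continuous_on_sum continuous_on_compose2[OF continuous_on_entropy_term]
      continuous_intros) (auto simp: transport_polytope_def)

lemma continuous_on_eot_objective: "continuous_on (transport_polytope r s) (eot_objective \<epsilon> c)"
  unfolding eot_objective_def by (intro continuous_intros continuous_on_entropy_matrix)

lemma continuous_on_epot_objective:
  "continuous_on (transport_polytope r s) (epot_objective \<epsilon> lam c)"
  unfolding epot_objective_def by (intro continuous_intros continuous_on_entropy_matrix)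

lemma compact_transport_polytope:
  fixes r :: "real^'k" and s :: "real^'l"
  shows "compact (transport_polytope r s)"
proof -
  have "closed (transport_polytope r s)"
    unfolding transport_polytope_def
    by (intro closed_Collect_conj closed_Collect_all closed_Collect_le closed_Collect_eq
        continuous_intros)
  moreover have "bounded (transport_polytope r s)"
  proof (rule boundedI)
    fix \<Gamma> assume \<Gamma>: "\<Gamma> \<in> transport_polytope r s"
    have le: "\<bar>\<Gamma> $ k $ l\<bar> \<le> \<bar>r $ k\<bar>" for k l
    proof -
      have "\<Gamma> $ k $ l \<le> (\<Sum>l\<in>UNIV. \<Gamma> $ k $ l)"
        using \<Gamma> by (intro member_le_sum) (auto simp: transport_polytope_def)
      then show ?thesis using \<Gamma> by (auto simp: transport_polytope_def)
    qed
    have "norm \<Gamma> \<le> (\<Sum>k\<in>UNIV. norm (\<Gamma> $ k))"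
      unfolding norm_vec_def by (intro L2_set_le_sum) simp
    also have "\<dots> \<le> (\<Sum>k\<in>UNIV. \<Sum>l\<in>UNIV. \<bar>\<Gamma> $ k $ l\<bar>)"
      by (intro sum_mono norm_le_l1_cart)
    also have "\<dots> \<le> (\<Sum>k\<in>UNIV. \<Sum>l\<in>(UNIV::'l set). \<bar>r $ k\<bar>)"
      by (intro sum_mono le)
    finally show "norm \<Gamma> \<le> (\<Sum>k\<in>UNIV. \<Sum>l\<in>(UNIV::'l set). \<bar>r $ k\<bar>)" .
  qed
  ultimately show ?thesis by (simp add: compact_eq_bounded_closed)
qed

text \<open>\<open>arg_min_on\<close> is a Hilbert choice, hence a genuine minimizer once some
  minimizer exists; compactness and continuity supply one.\<close>

lemma arg_min_on_compact:
  fixes f :: "'a::topological_space \<Rightarrow> real"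
  assumes "compact S" "S \<noteq> {}" "continuous_on S f"
  shows "arg_min_on f S \<in> S" and "\<And>x. x \<in> S \<Longrightarrow> f (arg_min_on f S) \<le> f x"
proof -
  obtain y where "y \<in> S" "\<And>x. x \<in> S \<Longrightarrow> f y \<le> f x"
    using continuous_attains_inf[OF assms] by blast
  then have "is_arg_min f (\<lambda>x. x \<in> S) y"
    by (auto simp: is_arg_min_linorder)
  then have "is_arg_min f (\<lambda>x. x \<in> S) (arg_min_on f S)"
    unfolding arg_min_on_def arg_min_def by (rule someI)
  then show "arg_min_on f S \<in> S" "\<And>x. x \<in> S \<Longrightarrow> f (arg_min_on f S) \<le> f x"
    by (auto simp: is_arg_min_linorder)
qed

lemma transport_polytope_nonempty:
  fixes a :: "real^'k" and b :: "real^'l"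
  assumes "\<And>k. 0 \<le> a $ k" "\<And>l. 0 \<le> b $ l"
    and "(\<Sum>k\<in>UNIV. a $ k) = 1" "(\<Sum>l\<in>UNIV. b $ l) = 1"
  shows "transport_polytope a b \<noteq> {}"
proof -
  \<comment> \<open>The independent coupling is the witness.\<close>
  have "(\<chi> k l. a $ k * b $ l) \<in> transport_polytope a b"
    using assms by (simp add: transport_polytope_def sum_distrib_left[symmetric] sum_distrib_right[symmetric])
  then show ?thesis by blast
qed

lemma eot_minimizer_is_minimizer:
  assumes "transport_polytope a b \<noteq> {}"
  shows "eot_minimizer \<epsilon> c a b \<in> transport_polytope a b"
    and "\<And>z. z \<in> transport_polytope a b \<Longrightarrow>
      eot_objective \<epsilon> c (eot_minimizer \<epsilon> c a b) \<le> eot_objective \<epsilon> c z"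
  unfolding eot_minimizer_def
  using arg_min_on_compact[OF compact_transport_polytope assms continuous_on_eot_objective] by blast+

text \<open>The midpoint of two distinct minimizers would do strictly better: the linear cost
  averages exactly, while the entropy falls strictly below the average.\<close>

lemma eot_minimizer_unique:
  assumes \<epsilon>: "0 < \<epsilon>" and x: "x \<in> transport_polytope a b" and y: "y \<in> transport_polytope a b"
    and min_x: "\<And>z. z \<in> transport_polytope a b \<Longrightarrow> eot_objective \<epsilon> c x \<le> eot_objective \<epsilon> c z"
    and min_y: "\<And>z. z \<in> transport_polytope a b \<Longrightarrow> eot_objective \<epsilon> c y \<le> eot_objective \<epsilon> c z"
  shows "x = y"
proof (rule ccontr)
  assume "x \<noteq> y"
  then obtain k0 l0 where ne: "x $ k0 $ l0 \<noteq> y $ k0 $ l0"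
    by (auto simp: vec_eq_iff)
  define z where "z = (\<chi> k l. (x $ k $ l + y $ k $ l) / 2)"
  have z_in: "z \<in> transport_polytope a b"
    using x y by (auto simp: transport_polytope_def z_def sum.distrib sum_divide_distrib[symmetric])
  let ?h = "\<lambda>t::real. t * (ln t - 1)"
  have nonneg: "0 \<le> x $ k $ l" "0 \<le> y $ k $ l" for k l
    using x y by (auto simp: transport_polytope_def)
  have le: "2 * ?h (z $ k $ l) \<le> ?h (x $ k $ l) + ?h (y $ k $ l)" for k l
    using entropy_term_midpoint(1)[OF nonneg] by (simp add: z_def)
  have lt: "2 * ?h (z $ k0 $ l0) < ?h (x $ k0 $ l0) + ?h (y $ k0 $ l0)"
    using entropy_term_midpoint(2)[OF nonneg ne] by (simp add: z_def)
  \<comment> \<open>Strictness at the entry \<open>(k0, l0)\<close> makes row \<open>k0\<close>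
    strict, and hence the double sum.\<close>
  have "(\<Sum>k\<in>UNIV. \<Sum>l\<in>UNIV. 2 * ?h (z $ k $ l))
      < (\<Sum>k\<in>UNIV. \<Sum>l\<in>UNIV. ?h (x $ k $ l) + ?h (y $ k $ l))"
    by (rule sum_strict_mono_ex1; (intro ballI bexI[of _ k0] sum_mono le sum_strict_mono_ex1 bexI[of _ l0] lt)?) auto
  then have ent: "2 * entropy_matrix z < entropy_matrix x + entropy_matrix y"
    by (simp add: entropy_matrix_def sum_distrib_left sum.distrib)
  have "2 * (\<Sum>k\<in>UNIV. \<Sum>l\<in>UNIV. c $ k $ l * z $ k $ l)
      = (\<Sum>k\<in>UNIV. \<Sum>l\<in>UNIV. c $ k $ l * x $ k $ l) + (\<Sum>k\<in>UNIV. \<Sum>l\<in>UNIV. c $ k $ l * y $ k $ l)"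
    by (simp add: z_def sum_distrib_left sum.distrib[symmetric] distrib_left add_divide_distrib)
  then have "2 * eot_objective \<epsilon> c z < eot_objective \<epsilon> c x + eot_objective \<epsilon> c y"
    using mult_strict_left_mono[OF ent \<epsilon>] by (simp add: eot_objective_def algebra_simps)
  then show False using min_x[OF z_in] min_y[OF z_in] by simp
qed

section \<open>The limit of the partial problem\<close>

lemma sum_UNIV_option:
  "(\<Sum>i\<in>UNIV. f i) = f None + (\<Sum>k\<in>UNIV. f (Some k))" for f :: "'k::finite option \<Rightarrow> 'a::comm_monoid_add"
  by (simp add: UNIV_option_conv sum.reindex)

text \<open>The competitor that sends no real mass to the dummy indices; the corner \<open>1\<close>
  then meets both dummy marginals.\<close>

definition extend_plan :: "real^'l^'k \<Rightarrow> real^('l option)^('k option)" where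
  "extend_plan \<omega> =
     (\<chi> i j. case (i, j) of (Some k, Some l) \<Rightarrow> \<omega> $ k $ l | (None, None) \<Rightarrow> 1 | _ \<Rightarrow> 0)"

lemma extend_plan_simps [simp]:
  "extend_plan \<omega> $ Some k $ Some l = \<omega> $ k $ l" "extend_plan \<omega> $ None $ None = 1"
  "extend_plan \<omega> $ Some k $ None = 0" "extend_plan \<omega> $ None $ Some l = 0"
  by (simp_all add: extend_plan_def)

lemma extend_plan_in_augmented_polytope:
  "\<omega> \<in> transport_polytope a b \<Longrightarrow>
    extend_plan \<omega> \<in> transport_polytope (augmented_weights a) (augmented_weights b)"
  unfolding transport_polytope_def
  by (auto simp: augmented_weights_def sum_UNIV_option extend_plan_def split: option.split)

lemma epot_minimizer_is_minimizer:
  fixes a :: "real^'k" and b :: "real^'l"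
  assumes "transport_polytope a b \<noteq> {}"
  defines "Q \<equiv> transport_polytope (augmented_weights a) (augmented_weights b)"
  shows "epot_minimizer \<epsilon> lam c a b \<in> Q"
    and "\<And>z. z \<in> Q \<Longrightarrow>
      epot_objective \<epsilon> lam c (epot_minimizer \<epsilon> lam c a b) \<le> epot_objective \<epsilon> lam c z"
proof -
  have "Q \<noteq> {}"
    using assms extend_plan_in_augmented_polytope by blast
  note min = arg_min_on_compact[OF compact_transport_polytope this[unfolded Q_def]
      continuous_on_epot_objective, folded Q_def]
  show "epot_minimizer \<epsilon> lam c a b \<in> Q"
    and "\<And>z. z \<in> Q \<Longrightarrow>
      epot_objective \<epsilon> lam c (epot_minimizer \<epsilon> lam c a b) \<le> epot_objective \<epsilon> lam c z"
    unfolding epot_minimizer_def Q_def[symmetric] using min by blast+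
qed

text \<open>The corner contributes \<open>1 * (ln 1 - 1) = -1\<close> and the zero border
  contributes nothing.\<close>

lemma entropy_extend_plan: "entropy_matrix (extend_plan \<omega>) = entropy_matrix \<omega> - 1"
  by (simp add: entropy_matrix_def sum_UNIV_option)

text \<open>Collecting the \<open>- 2 * lam\<close> of the real costs with the constant
  \<open>2 * lam\<close> isolates the dependence on \<open>lam\<close> as a penalty on missing real
  mass.\<close>

lemma epot_objective_eq:
  "epot_objective \<epsilon> lam c \<Gamma> =
    (\<Sum>k\<in>UNIV. \<Sum>l\<in>UNIV. c $ k $ l * \<Gamma> $ Some k $ Some l) + \<epsilon> * entropy_matrix \<Gamma>
      + 2 * lam * (1 - (\<Sum>k\<in>UNIV. \<Sum>l\<in>UNIV. \<Gamma> $ Some k $ Some l))"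
  by (simp add: epot_objective_def augmented_cost_def sum_UNIV_option left_diff_distrib
      sum_subtractf sum_distrib_left algebra_simps)

text \<open>The real columns carry total mass one, split between the dummy row and the real block;
  the dummy row also sums to one, its remainder being the corner.\<close>

lemma real_block_mass:
  fixes a :: "real^'k" and b :: "real^'l"
  assumes "\<Gamma> \<in> transport_polytope (augmented_weights a) (augmented_weights b)"
    and "(\<Sum>l\<in>UNIV. b $ l) = 1"
  shows "(\<Sum>k\<in>UNIV. \<Sum>l\<in>UNIV. \<Gamma> $ Some k $ Some l) = \<Gamma> $ None $ None"
proof -
  have col: "\<Gamma> $ None $ Some l + (\<Sum>k\<in>UNIV. \<Gamma> $ Some k $ Some l) = b $ l" for l
    using assms(1) by (auto simp: transport_polytope_def augmented_weights_def sum_UNIV_option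
        dest!: conjunct2 conjunct2 spec[of _ "Some l"])
  have row: "\<Gamma> $ None $ None + (\<Sum>l\<in>UNIV. \<Gamma> $ None $ Some l) = 1"
    using assms(1) by (auto simp: transport_polytope_def augmented_weights_def sum_UNIV_option
        dest!: spec[of _ None])
  have "(\<Sum>l\<in>UNIV. \<Gamma> $ None $ Some l) + (\<Sum>l\<in>UNIV. \<Sum>k\<in>UNIV. \<Gamma> $ Some k $ Some l) = 1"
    using assms(2) by (simp add: sum.distrib[symmetric] col)
  then show ?thesis using row by (subst sum.swap) simp
qed

text \<open>A corner equal to \<open>1\<close> exhausts the marginals of the dummy row and column,
  so their other nonnegative entries vanish.\<close>

lemma full_mass_eq_extend_plan:
  fixes a :: "real^'k" and b :: "real^'l"
  assumes \<Gamma>: "\<Gamma> \<in> transport_polytope (augmented_weights a) (augmented_weights b)"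
    and full: "\<Gamma> $ None $ None = 1"
  shows "real_block \<Gamma> \<in> transport_polytope a b" and "\<Gamma> = extend_plan (real_block \<Gamma>)"
proof -
  have nonneg: "0 \<le> \<Gamma> $ i $ j"
    and row: "(\<Sum>j\<in>UNIV. \<Gamma> $ i $ j) = augmented_weights a $ i"
    and col: "(\<Sum>i\<in>UNIV. \<Gamma> $ i $ j) = augmented_weights b $ j" for i j
    using \<Gamma> by (auto simp: transport_polytope_def)
  have "(\<Sum>l\<in>UNIV. \<Gamma> $ None $ Some l) = 0"
    using row[of None] full by (simp add: sum_UNIV_option augmented_weights_def)
  then have None_Some: "\<Gamma> $ None $ Some l = 0" for l
    by (simp add: sum_nonneg_eq_0_iff nonneg)
  have "(\<Sum>k\<in>UNIV. \<Gamma> $ Some k $ None) = 0"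
    using col[of None] full by (simp add: sum_UNIV_option augmented_weights_def)
  then have Some_None: "\<Gamma> $ Some k $ None = 0" for k
    by (simp add: sum_nonneg_eq_0_iff nonneg)
  show "real_block \<Gamma> \<in> transport_polytope a b"
    using nonneg row[of "Some _"] col[of "Some _"]
    by (simp add: transport_polytope_def real_block_def sum_UNIV_option augmented_weights_def
        None_Some Some_None)
  show "\<Gamma> = extend_plan (real_block \<Gamma>)"
    by (auto simp: vec_eq_iff extend_plan_def real_block_def full None_Some Some_None split: option.split)
qed

text \<open>Otherwise \<open>g (f t)\<close> stays away from \<open>y\<close> along some times
  tending to infinity; compactness yields a cluster point of \<open>f\<close> there, contradicting
  \<open>cluster\<close>. Only \<open>g\<close> at cluster points must be identified, not the limit
  of \<open>f\<close> itself.\<close>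

lemma tendsto_at_top_compactI:
  fixes f :: "real \<Rightarrow> 'a::metric_space" and g :: "'a \<Rightarrow> 'b::metric_space"
  assumes "compact S" "continuous_on S g" "\<And>t. 0 < t \<Longrightarrow> f t \<in> S"
    and cluster: "\<And>t x. filterlim t at_top sequentially \<Longrightarrow> (\<And>n. 0 < t n) \<Longrightarrow>
      (\<lambda>n. f (t n)) \<longlonglongrightarrow> x \<Longrightarrow> x \<in> S \<Longrightarrow> g x = y"
  shows "((\<lambda>t. g (f t)) \<longlongrightarrow> y) at_top"
proof (rule ccontr)
  assume "\<not> ?thesis"
  then obtain e where e: "0 < e" and "\<not> eventually (\<lambda>t. dist (g (f t)) y < e) at_top"
    by (auto simp: tendsto_iff)
  \<comment> \<open>Using \<open>Suc n\<close> keeps every chosen time positive, including the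
    first.\<close>
  then have "\<exists>t\<ge>real (Suc n). \<not> dist (g (f t)) y < e" for n
    by (auto simp: eventually_at_top_linorder)
  then obtain t where t: "\<And>n. real (Suc n) \<le> t n" and far: "\<And>n. \<not> dist (g (f (t n))) y < e"
    by metis
  have pos: "0 < t n" for n
    using t[of n] by simp
  obtain x r where x: "x \<in> S" and r: "strict_mono r" and lim: "(\<lambda>n. f (t (r n))) \<longlonglongrightarrow> x"
    using assms(1) assms(3)[OF pos] unfolding compact_def
    by (metis (no_types, lifting) comp_def ext)
  have "filterlim (\<lambda>n. real (Suc n)) at_top sequentially"
    by real_asymp
  then have "filterlim t at_top sequentially"
    by (rule filterlim_at_top_mono) (intro always_eventually allI t)
  then have "filterlim (\<lambda>n. t (r n)) at_top sequentially"
    using filterlim_compose filterlim_subseq[OF r] by blast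
  then have "g x = y"
    using pos lim x by (intro cluster)
  moreover have "(\<lambda>n. g (f (t (r n)))) \<longlonglongrightarrow> g x"
    using assms(3)[OF pos] by (intro continuous_on_tendsto_compose[OF assms(2) lim x]) auto
  ultimately have "eventually (\<lambda>n. dist (g (f (t (r n)))) y < e) sequentially"
    using e by (simp add: tendsto_iff)
  then show False using far by (auto simp: eventually_sequentially)
qed

text \<open>Missing real mass costs \<open>2 * lam\<close> per unit, so in the limit all of it is
  transported and only the balanced objective is left to be minimized.\<close>

lemma epot_real_block_tendsto:
  fixes a :: "real^'k" and b :: "real^'l" and c :: "real^'l^'k"
  assumes a: "\<And>k. 0 \<le> a $ k" and b: "\<And>l. 0 \<le> b $ l"
    and sums: "(\<Sum>k\<in>UNIV. a $ k) = 1" "(\<Sum>l\<in>UNIV. b $ l) = 1" and \<epsilon>: "0 < \<epsilon>"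
  shows "((\<lambda>lam. real_block (epot_minimizer \<epsilon> lam c a b)) \<longlongrightarrow> eot_minimizer \<epsilon> c a b) at_top"
proof -
  let ?P = "transport_polytope a b"
  let ?Q = "transport_polytope (augmented_weights a) (augmented_weights b)"
  let ?\<omega> = "eot_minimizer \<epsilon> c a b" and ?\<Gamma> = "\<lambda>lam. epot_minimizer \<epsilon> lam c a b"
  define F where "F = (\<lambda>\<Gamma> :: real^('l option)^('k option).
    (\<Sum>k\<in>UNIV. \<Sum>l\<in>UNIV. c $ k $ l * \<Gamma> $ Some k $ Some l) + \<epsilon> * entropy_matrix \<Gamma>)"
  \<comment> \<open>The shift by \<open>\<epsilon>\<close> comes from the corner entropy
    \<open>-1\<close>; being constant, it does not affect comparisons.\<close>
  have F_extend: "F (extend_plan \<omega>) = eot_objective \<epsilon> c \<omega> - \<epsilon>" for \<omega>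
    by (simp add: F_def entropy_extend_plan eot_objective_def right_diff_distrib)
  have F_cont: "continuous_on ?Q F"
    unfolding F_def by (intro continuous_intros continuous_on_entropy_matrix)
  note P_ne = transport_polytope_nonempty[OF a b sums]
  note \<omega> = eot_minimizer_is_minimizer(1)[OF P_ne, of \<epsilon> c]
    and \<omega>_min = eot_minimizer_is_minimizer(2)[OF P_ne, of _ \<epsilon> c]
    and \<Gamma> = epot_minimizer_is_minimizer(1)[OF P_ne, of \<epsilon> _ c]
    and \<Gamma>_min = epot_minimizer_is_minimizer(2)[OF P_ne, of _ \<epsilon> _ c]
  note ext = extend_plan_in_augmented_polytope[OF \<omega>]
  have objective: "epot_objective \<epsilon> lam c z = F z + 2 * lam * (1 - z $ None $ None)"
    if "z \<in> ?Q" for lam z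
    using real_block_mass[OF that sums(2)] by (simp add: epot_objective_eq F_def)
  have corner_le: "z $ None $ None \<le> 1" if "z \<in> ?Q" for z
  proof -
    have "z $ None $ None \<le> (\<Sum>j\<in>UNIV. z $ None $ j)"
      using that by (intro member_le_sum) (auto simp: transport_polytope_def)
    then show ?thesis using that by (auto simp: transport_polytope_def augmented_weights_def)
  qed
  have upper: "F (?\<Gamma> lam) + 2 * lam * (1 - ?\<Gamma> lam $ None $ None) \<le> F (extend_plan ?\<omega>)" for lam
    using \<Gamma>_min[OF ext, of lam] objective[OF \<Gamma>, of lam lam] objective[OF ext, of lam]
    by simp
  show ?thesis
  proof (rule tendsto_at_top_compactI[where S = ?Q])
    show "compact ?Q" by (rule compact_transport_polytope)
    show "continuous_on ?Q real_block"
      unfolding real_block_def by (intro continuous_intros)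
    show "?\<Gamma> lam \<in> ?Q" for lam by (rule \<Gamma>)
  next
    fix t :: "nat \<Rightarrow> real" and x
    assume t: "filterlim t at_top sequentially" "\<And>n. 0 < t n"
      and lim: "(\<lambda>n. ?\<Gamma> (t n)) \<longlonglongrightarrow> x" and x: "x \<in> ?Q"
    have F_lim: "(\<lambda>n. F (?\<Gamma> (t n))) \<longlonglongrightarrow> F x"
      using \<Gamma> by (intro continuous_on_tendsto_compose[OF F_cont lim x]) auto
    have corner_lim: "(\<lambda>n. ?\<Gamma> (t n) $ None $ None) \<longlonglongrightarrow> x $ None $ None"
      by (intro tendsto_intros lim)
    \<comment> \<open>The numerator converges by continuity of \<open>F\<close> while the
      denominator diverges; this quotient bounds the corner deficit.\<close>
    have "(\<lambda>n. (F (extend_plan ?\<omega>) - F (?\<Gamma> (t n))) / (2 * t n)) \<longlonglongrightarrow> 0"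
      by (rule tendsto_divide_0[OF tendsto_diff[OF tendsto_const F_lim]])
        (intro filterlim_at_top_imp_at_infinity filterlim_tendsto_pos_mult_at_top[OF tendsto_const _ t(1)], simp)
    moreover have "1 - ?\<Gamma> (t n) $ None $ None \<le> (F (extend_plan ?\<omega>) - F (?\<Gamma> (t n))) / (2 * t n)" for n
      using upper[of "t n"] t(2)[of n] by (simp add: field_simps)
    ultimately have "1 - x $ None $ None \<le> 0"
      by (intro LIMSEQ_le[OF tendsto_diff[OF tendsto_const corner_lim]]) auto
    then have full: "x $ None $ None = 1"
      using corner_le[OF x] by simp
    note x_ext = full_mass_eq_extend_plan[OF x full]
    \<comment> \<open>Dropping the nonnegative penalty from \<open>upper\<close> leaves a bound free
      of \<open>t n\<close>, which survives the limit.\<close>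
    have "F (?\<Gamma> (t n)) \<le> F (extend_plan ?\<omega>)" for n
      using upper[of "t n"] t(2)[of n] corner_le[OF \<Gamma>, of "t n"]
      by (smt (verit) mult_nonneg_nonneg)
    then have "F x \<le> F (extend_plan ?\<omega>)"
      by (intro LIMSEQ_le_const2[OF F_lim]) auto
    then have "eot_objective \<epsilon> c (real_block x) \<le> eot_objective \<epsilon> c ?\<omega>"
      using F_extend[of "real_block x"] F_extend[of ?\<omega>] by (simp add: x_ext(2)[symmetric])
    then show "real_block x = ?\<omega>"
      using \<omega>_min by (intro eot_minimizer_unique[OF \<epsilon> x_ext(1) \<omega>, of c]) force+
  qed
qed

section \<open>Convergence of the induced plans\<close>

text \<open>This exhibits the integral as linear in \<open>\<omega>\<close> with coefficients
  independent of it. Each coefficient is well behaved because \<open>\<phi>\<close> is bounded and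
  the pushforward is finite.\<close>

lemma integral_induced_plan:
  fixes m0 :: "'k::finite \<Rightarrow> real^'d" and m1 :: "'l::finite \<Rightarrow> real^'d"
    and \<phi> :: "(real^'d) \<times> (real^'d) \<Rightarrow> real"
  assumes S0: "\<And>k. pd_matrix (S0 k)" and \<omega>: "\<And>k l. 0 \<le> \<omega> $ k $ l"
    and \<phi>: "continuous_on UNIV \<phi>" "bounded (range \<phi>)"
  shows "(\<integral>z. \<phi> z \<partial>induced_plan m0 S0 m1 S1 \<omega>)
    = (\<Sum>(k, l)\<in>UNIV. \<omega> $ k $ l *
        (\<integral>z. \<phi> z \<partial>distr (gaussian_measure (m0 k) (S0 k)) borel
           (\<lambda>x. (x, gaussian_ot_map (m0 k) (S0 k) (m1 l) (S1 l) x))))"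
proof -
  let ?T = "\<lambda>k l x. (x, gaussian_ot_map (m0 k) (S0 k) (m1 l) (S1 l) x)"
  have int: "integrable (distr (gaussian_measure (m0 k) (S0 k)) borel (?T k l)) \<phi>" for k l
  proof -
    have "continuous_on UNIV (?T k l)"
      unfolding gaussian_ot_map_def
      by (intro continuous_intros bounded_linear.continuous_on[OF matrix_vector_mul_bounded_linear])
    then have T: "?T k l \<in> measurable (gaussian_measure (m0 k) (S0 k)) borel"
      using borel_measurable_continuous_onI[of "?T k l"] by (simp add: gaussian_measure_def)
    interpret finite_measure "distr (gaussian_measure (m0 k) (S0 k)) borel (?T k l)"
      by (rule finite_measure.finite_measure_distr[OF finite_gaussian_measure[OF S0] T])
    obtain B where "\<And>z. norm (\<phi> z) \<le> B"
      using \<phi>(2) by (auto simp: bounded_iff)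
    then show ?thesis
      using borel_measurable_continuous_onI[OF \<phi>(1)] by (intro integrable_const_bound[of _ B]) auto
  qed
  show ?thesis
    unfolding induced_plan_def
    by (subst integral_weighted_sum_measure) (use \<omega> int in \<open>auto simp: case_prod_beta\<close>)
qed

theorem theorem4p1:
  fixes a :: "real^'k" and b :: "real^'l"
    and m0 :: "'k \<Rightarrow> real^'d" and S0 :: "'k \<Rightarrow> real^'d^'d"
    and m1 :: "'l \<Rightarrow> real^'d" and S1 :: "'l \<Rightarrow> real^'d^'d"
    and \<mu>k :: "'k \<Rightarrow> (real^'d) measure" and \<nu>l :: "'l \<Rightarrow> (real^'d) measure"
    and \<mu> \<nu> :: "(real^'d) measure"
    and c :: "real^'l^'k" and \<epsilon> :: real
    and \<omega>\<epsilon>lam :: "real \<Rightarrow> real^'l^'k" and \<omega>\<epsilon> :: "real^'l^'k"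
  assumes "\<And>k. a $ k > 0" and "\<And>l. b $ l > 0"
    and "(\<Sum>k\<in>UNIV. a $ k) = 1" and "(\<Sum>l\<in>UNIV. b $ l) = 1"
    and "\<And>k. pd_matrix (S0 k)" and "\<And>l. pd_matrix (S1 l)"
    and "\<And>k. \<mu>k k = gaussian_measure (m0 k) (S0 k)"
    and "\<And>l. \<nu>l l = gaussian_measure (m1 l) (S1 l)"
    and "\<mu> = weighted_sum_measure (\<lambda>k. a $ k) \<mu>k"
    and "\<nu> = weighted_sum_measure (\<lambda>l. b $ l) \<nu>l"
    and "c = (\<chi> k l. (wasserstein2 (\<mu>k k) (\<nu>l l))\<^sup>2)"
    and "\<epsilon> > 0"
    and "\<And>lam. lam > 0 \<Longrightarrow> \<omega>\<epsilon>lam lam = real_block (epot_minimizer \<epsilon> lam c a b)"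
    and "\<omega>\<epsilon> = eot_minimizer \<epsilon> c a b"
  shows "\<forall>\<phi> :: (real^'d) \<times> (real^'d) \<Rightarrow> real.
           continuous_on UNIV \<phi> \<and> bounded (range \<phi>) \<longrightarrow>
           ((\<lambda>lam. \<integral>z. \<phi> z \<partial>(induced_plan m0 S0 m1 S1 (\<omega>\<epsilon>lam lam)))
              \<longlongrightarrow> (\<integral>z. \<phi> z \<partial>(induced_plan m0 S0 m1 S1 \<omega>\<epsilon>))) at_top"
proof (intro allI impI)
  fix \<phi> :: "(real^'d) \<times> (real^'d) \<Rightarrow> real"
  assume \<phi>: "continuous_on UNIV \<phi> \<and> bounded (range \<phi>)"
  define J where "J = (\<lambda>k l. \<integral>z. \<phi> z \<partial>distr (gaussian_measure (m0 k) (S0 k)) borel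
    (\<lambda>x. (x, gaussian_ot_map (m0 k) (S0 k) (m1 l) (S1 l) x)))"
  have integral: "(\<integral>z. \<phi> z \<partial>induced_plan m0 S0 m1 S1 \<omega>) = (\<Sum>(k, l)\<in>UNIV. \<omega> $ k $ l * J k l)"
    if "\<And>k l. 0 \<le> \<omega> $ k $ l" for \<omega>
    unfolding J_def using \<phi> assms(5) that by (intro integral_induced_plan) auto
  have nonneg: "0 \<le> a $ k" "0 \<le> b $ l" for k l
    using assms(1,2) by (simp_all add: less_imp_le)
  note P_ne = transport_polytope_nonempty[OF nonneg assms(3,4)]
  let ?\<omega> = "\<lambda>lam. real_block (epot_minimizer \<epsilon> lam c a b)"
  \<comment> \<open>Feasibility holds for every real \<open>lam\<close>, so the integral formula
    below applies without restricting to positive values.\<close>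
  have block: "0 \<le> ?\<omega> lam $ k $ l" for lam k l
    using epot_minimizer_is_minimizer(1)[OF P_ne, of \<epsilon> lam c]
    by (simp add: transport_polytope_def real_block_def)
  have balanced: "0 \<le> \<omega>\<epsilon> $ k $ l" for k l
    using eot_minimizer_is_minimizer(1)[OF P_ne, of \<epsilon> c]
    by (simp add: transport_polytope_def assms(14))
  have "(?\<omega> \<longlongrightarrow> \<omega>\<epsilon>) at_top"
    using epot_real_block_tendsto[OF nonneg assms(3,4,12)] by (simp add: assms(14))
  then have "((\<lambda>lam. \<Sum>(k, l)\<in>UNIV. ?\<omega> lam $ k $ l * J k l)
      \<longlongrightarrow> (\<Sum>(k, l)\<in>UNIV. \<omega>\<epsilon> $ k $ l * J k l)) at_top"
    unfolding case_prod_beta by (intro tendsto_intros)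
  then have "((\<lambda>lam. \<integral>z. \<phi> z \<partial>induced_plan m0 S0 m1 S1 (?\<omega> lam))
      \<longlongrightarrow> (\<integral>z. \<phi> z \<partial>induced_plan m0 S0 m1 S1 \<omega>\<epsilon>)) at_top"
    by (simp only: integral[OF block] integral[OF balanced])
  then show "((\<lambda>lam. \<integral>z. \<phi> z \<partial>induced_plan m0 S0 m1 S1 (\<omega>\<epsilon>lam lam))
      \<longlongrightarrow> (\<integral>z. \<phi> z \<partial>induced_plan m0 S0 m1 S1 \<omega>\<epsilon>)) at_top"
    \<comment> \<open>The family \<open>\<omega>\<epsilon>lam\<close> is prescribed only for
      positive \<open>lam\<close>, which suffices because this holds eventually at infinity.\<close>
    by (rule Lim_transform_eventually)
      (auto intro!: eventually_mono[OF eventually_gt_at_top[of 0]] simp: assms(13))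
qed

end
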